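(* Let $X=(X,\|\cdot\|)$ be a Banach space and let $(A_n)_{n\in\mathbb{Z}}$ be a sequence of invertible bounded linear operators on $X$ that admits a generalized exponential dichotomy, with associated closed subspaces $S(n), U(n)\subset X$, $n\in\mathbb{Z}$. Then there exists $c_0>0$, depending only on $(A_n)_{n\in\mathbb{Z}}$ and the data of its generalized exponential dichotomy, such that the following holds for every $c\in(0,c_0]$. Let $(f_n)_{n\in\mathbb{Z}}$ be any sequence of maps $f_n\colon X\to X$ such that: (1) $\|f_n(x)-f_n(y)\|\le c\|x-y\|$ for all $n\in\mathbb{Z}$ and $x,y\in X$; (2) $A_n+f_n$ is a homeomorphism of $X$ for each $n\in\mathbb{Z}$; (3) $\sup_{n\in\mathbb{Z}}\|f_n\|_\infty<+\infty$. Then there exists a sequence $(H_n)_{n\in\mathbb{Z}}$ of homeomorphisms of $X$ such that: (i) $H_{n+1}\circ A_n=(A_n+f_n)\circ H_n$ for every $n\in\mathbb{Z}$; (ii) $\sup_{n\in\mathbb{Z}}\|H_n-\mathrm{Id}\|_\infty<+\infty$; (iii) $H_n(x)-x\in S(n)+A_n^{-1}U(n+1)$ for every $n\in\mathbb{Z}$ and $x\in X$. Moreover, the sequence $(H_n)_{n\in\mathbb{Z}}$ of homeomorphisms with properties (i), (ii), (iii) is unique.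
   Context: For a map $g\colon X\to X$, $\|g\|_\infty:=\sup\{\|g(x)\|: x\in X\}$. Linear cocycle: for a sequence $(A_n)_{n\in\mathbb{Z}}$ of invertible bounded linear operators on $X$ (with bounded inverses), define $\mathcal{A}(m,n)=A_{m-1}\cdots A_n$ if $m>n$, $\mathcal{A}(n,n)=\mathrm{Id}$, and $\mathcal{A}(m,n)=A_m^{-1}\cdots A_{n-1}^{-1}$ if $m<n$. Generalized exponential dichotomy: $(A_n)_{n\in\mathbb{Z}}$ admits a generalized exponential dichotomy if - for each $n\in\mathbb{Z}$ there are closed subspaces $S(n)$ and $U(n)$ of $X$ with $X=S(n)\oplus U(n)$; - for each $n\in\mathbb{Z}$, $A_nS(n)\subset S(n+1)$ and $A_n^{-1}U(n+1)\subset U(n)$ (inclusions, not necessarily equalities); - there exist $D,\lambda>0$ such that $\|\mathcal{A}(m,n)x\|\le De^{-\lambda(m-n)}\|x\|$ for $x\in S(n)$ and $m\ge n$, and $\|\mathcal{A}(m,n)x\|\le De^{-\lambda(n-m)}\|x\|$ for $x\in U(n)$ and $m\le n$; - $\sup_{n\in\mathbb{Z}}\|P_n\|<\infty$, where $P_n\colon X\to S(n)$ is the projection onto $S(n)$ along $U(n)$ associated with $X=S(n)\oplus U(n)$. The data of the dichotomy are the subspaces $S(n),U(n)$ and the constants $D$, $\lambda$, $\sup_n\|P_n\|$. *)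

theory Defs
  imports "HOL-Analysis.Analysis"
begin

text \<open>Extended-real valued, so that the supremum over an unbounded set is infinite.\<close>

definition sup_norm :: "('a \<Rightarrow> 'b::real_normed_vector) \<Rightarrow> ereal" where
  "sup_norm g = (SUP x. ereal (norm (g x)))"

definition invertible_operator :: "('a::real_normed_vector \<Rightarrow> 'a) \<Rightarrow> bool" where
  "invertible_operator T \<longleftrightarrow> bounded_linear T \<and> bij T \<and> bounded_linear (inv T)"

primrec forward_cocycle :: "(int \<Rightarrow> 'a \<Rightarrow> 'a) \<Rightarrow> int \<Rightarrow> nat \<Rightarrow> 'a \<Rightarrow> 'a" where
  "forward_cocycle A n 0 = id"
| "forward_cocycle A n (Suc k) = A (n + int k) \<circ> forward_cocycle A n k"

primrec backward_cocycle :: "(int \<Rightarrow> 'a \<Rightarrow> 'a) \<Rightarrow> int \<Rightarrow> nat \<Rightarrow> 'a \<Rightarrow> 'a" where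
  "backward_cocycle A n 0 = id"
| "backward_cocycle A n (Suc k) = inv (A (n - 1 - int k)) \<circ> backward_cocycle A n k"

text \<open>
  For \<open>m > n\<close> this is \<open>A (m - 1) \<circ> \<dots> \<circ> A n\<close>, and for \<open>m < n\<close> it is
  \<open>inv (A m) \<circ> \<dots> \<circ> inv (A (n - 1))\<close>.
\<close>

definition cocycle :: "(int \<Rightarrow> 'a \<Rightarrow> 'a) \<Rightarrow> int \<Rightarrow> int \<Rightarrow> 'a \<Rightarrow> 'a" where
  "cocycle A m n =
     (if n \<le> m then forward_cocycle A n (nat (m - n)) else backward_cocycle A n (nat (n - m)))"

definition direct_sum_UNIV :: "'a::real_vector set \<Rightarrow> 'a set \<Rightarrow> bool" where
  "direct_sum_UNIV S U \<longleftrightarrow>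
     subspace S \<and> subspace U \<and> S \<inter> U = {0} \<and> {s + u | s u. s \<in> S \<and> u \<in> U} = UNIV"

text \<open>Projection onto \<open>S\<close> along \<open>U\<close>; meaningful when the space is the direct sum of the two.\<close>

definition projection_along :: "'a::real_vector set \<Rightarrow> 'a set \<Rightarrow> 'a \<Rightarrow> 'a" where
  "projection_along S U x = (THE s. s \<in> S \<and> x - s \<in> U)"

text \<open>
  Boundedness of each projection is stated explicitly because \<^const>\<open>onorm\<close> is the operator norm
  only for bounded operators; in a Banach space it is automatic, as the subspaces are closed.
\<close>

definition generalized_exponential_dichotomy ::
  "(int \<Rightarrow> 'a::real_normed_vector \<Rightarrow> 'a) \<Rightarrow> (int \<Rightarrow> 'a set) \<Rightarrow> (int \<Rightarrow> 'a set) \<Rightarrow> real \<Rightarrow> real \<Rightarrow> bool"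
where
  "generalized_exponential_dichotomy A S U D lam \<longleftrightarrow>
     (\<forall>n. closed (S n) \<and> closed (U n) \<and> direct_sum_UNIV (S n) (U n)) \<and>
     (\<forall>n. A n ` S n \<subseteq> S (n + 1) \<and> inv (A n) ` U (n + 1) \<subseteq> U n) \<and>
     D > 0 \<and> lam > 0 \<and>
     (\<forall>m n. \<forall>x\<in>S n. m \<ge> n \<longrightarrow>
        norm (cocycle A m n x) \<le> D * exp (- lam * real_of_int (m - n)) * norm x) \<and>
     (\<forall>m n. \<forall>x\<in>U n. m \<le> n \<longrightarrow>
        norm (cocycle A m n x) \<le> D * exp (- lam * real_of_int (n - m)) * norm x) \<and>
     (\<forall>n. bounded_linear (projection_along (S n) (U n))) \<and>
     bdd_above (range (\<lambda>n. onorm (projection_along (S n) (U n))))"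

end

theory Submission
  imports Defs
begin

text \<open>
  A sequence \<open>H\<close> conjugates \<open>A\<close> to \<open>A + f\<close> exactly when, along each orbit of \<open>A\<close>, the displacement
  \<open>H n x - x\<close> solves the inhomogeneous linear equation \<open>v (n + 1) = A n (v n) + y (n + 1)\<close>, where the
  forcing \<open>y\<close> is \<open>f\<close> evaluated at \<open>H\<close>.  For a bounded forcing this equation has one and only one
  bounded solution with values in \<open>E n = S n + inv (A n) ` U (n + 1)\<close>.  It is given by the Green
  operator, which sums the stable part of the forcing over the past and the unstable part over
  the future (\<open>green_step\<close>, \<open>green_in_E\<close>, \<open>norm_green\<close>).  It is unique because \<open>A n\<close> maps \<open>S n\<close> into
  \<open>S (n + 1)\<close> and the unstable summand of \<open>E n\<close> into \<open>U (n + 1)\<close>: the two components of a bounded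
  orbit in \<open>E\<close> evolve separately and both have to vanish (\<open>bounded_orbit_in_E_eq_0\<close>).  This is why
  displacements are required to lie in \<open>E n\<close>: a bounded orbit of \<open>A\<close> that leaves \<open>E\<close> need not
  vanish, since \<open>A n\<close> may map a vector of \<open>U n\<close> to one with a stable component.

  The Green operator has norm at most \<open>green_const\<close>.  For \<open>c0 = 1 / (2 * green_const)\<close> the
  resulting fixed point equation for the displacement is therefore a contraction, and it
  preserves continuity.

  To see that \<open>H\<close> is a homeomorphism, the conjugacy problem is solved more generally between any
  two bounded perturbations \<open>F\<close> and \<open>G\<close> of \<open>A\<close> with Lipschitz constant at most \<open>c0\<close>
  (\<open>ex_continuous_conjugacy\<close>, \<open>conjugacy_unique\<close>).  Besides \<open>H\<close> this gives a conjugacy from \<open>A + f\<close>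
  back to \<open>A\<close>.  Both compositions conjugate a perturbation to itself and again have displacements
  in the subspaces \<open>E n\<close>, so uniqueness identifies them with the identity.
\<close>

section \<open>Cocycles of bijections\<close>

lemma cocycle_refl [simp]: "cocycle F n n x = x"
  by (simp add: cocycle_def)

lemma cocycle_step:
  assumes "\<And>n. bij (F n)"
  shows "cocycle F (m + 1) n x = F m (cocycle F m n x)"
proof (cases "n \<le> m")
  case True
  then have "nat (m + 1 - n) = Suc (nat (m - n))"
    by simp
  with True show ?thesis
    by (simp add: cocycle_def)
next
  case False
  then have 1: "nat (n - m) = Suc (nat (n - (m + 1)))" and 2: "n - 1 - int (nat (n - (m + 1))) = m"
    by simp_all
  have "cocycle F m n x = inv (F m) (backward_cocycle F n (nat (n - (m + 1))) x)"
    using False by (simp add: cocycle_def 1 2 del: diff_add_eq diff_diff_eq2)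
  moreover have "cocycle F (m + 1) n x = backward_cocycle F n (nat (n - (m + 1))) x"
    using False by (simp add: cocycle_def)
  ultimately show ?thesis
    using assms by (simp add: bij_is_surj surj_f_inv_f)
qed

text \<open>
  For bijections an orbit is determined by any one of its points; this also covers negative times.
\<close>

lemma cocycle_orbit:
  assumes bij: "\<And>n. bij (F n)" and orbit: "\<And>n. v (n + 1) = F n (v n)"
  shows "cocycle F m n (v n) = v m"
proof (induction m rule: int_induct[where k = n])
  case base
  show ?case by simp
next
  case (step1 i)
  then show ?case
    by (simp add: cocycle_step[of F, OF bij] orbit)
next
  case (step2 i)
  have "F (i - 1) (cocycle F (i - 1) n (v n)) = F (i - 1) (v (i - 1))"
    using step2 cocycle_step[of F, OF bij, of "i - 1" n "v n"] orbit[of "i - 1"] by simp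
  then show ?case
    using bij by (meson bij_is_inj injD)
qed

lemma cocycle_shift:
  assumes "\<And>n. bij (F n)"
  shows "cocycle F m (n + 1) (F n x) = cocycle F m n x"
  using cocycle_orbit[where F = F and v = "\<lambda>k. cocycle F k n x" and n = "n + 1", OF assms cocycle_step[of F, OF assms]]
  by (simp add: cocycle_step[of F, OF assms])

lemma continuous_on_cocycle:
  fixes F :: "int \<Rightarrow> 'a::topological_space \<Rightarrow> 'a"
  assumes "\<And>n. continuous_on UNIV (F n)" "\<And>n. continuous_on UNIV (inv (F n))"
  shows "continuous_on UNIV (cocycle F m n)"
proof -
  have "continuous_on UNIV (forward_cocycle F n k)" for k
    by (induction k) (auto simp: id_def comp_def intro: continuous_on_compose2[OF assms(1)])
  moreover have "continuous_on UNIV (backward_cocycle F n k)" for k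
    by (induction k) (auto simp: id_def comp_def intro: continuous_on_compose2[OF assms(2)])
  ultimately show ?thesis
    by (simp add: cocycle_def)
qed

lemma bounded_linear_cocycle:
  assumes "\<And>n. bounded_linear (F n)" "\<And>n. bounded_linear (inv (F n))"
  shows "bounded_linear (cocycle F m n)"
proof -
  have "bounded_linear (forward_cocycle F n k)" for k
    by (induction k) (simp_all add: id_def comp_def bounded_linear_ident bounded_linear_compose[OF assms(1)])
  moreover have "bounded_linear (backward_cocycle F n k)" for k
    by (induction k) (simp_all add: id_def comp_def bounded_linear_ident bounded_linear_compose[OF assms(2)])
  ultimately show ?thesis
    by (simp add: cocycle_def)
qed

section \<open>Suprema, geometric decay and discrete parameters\<close>

lemma SUP_sup_norm_less_infinity_iff:
  "(SUP n. sup_norm (g n)) < \<infinity> \<longleftrightarrow> (\<exists>M. \<forall>n x. norm (g n x) \<le> M)"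
proof
  assume fin: "(SUP n. sup_norm (g n)) < \<infinity>"
  have le: "ereal (norm (g n x)) \<le> (SUP n. sup_norm (g n))" for n x
    unfolding sup_norm_def by (intro SUP_upper2[of n] SUP_upper2[of x]) auto
  show "\<exists>M. \<forall>n x. norm (g n x) \<le> M"
  proof (cases "SUP n. sup_norm (g n)")
    case (real M)
    then show ?thesis using le by auto
  next
    case PInf
    then show ?thesis using fin by simp
  next
    case MInf
    then show ?thesis using le by auto
  qed
next
  assume "\<exists>M. \<forall>n x. norm (g n x) \<le> M"
  then obtain M where M: "\<And>n x. norm (g n x) \<le> M" by blast
  have "(SUP n. sup_norm (g n)) \<le> ereal M"
    unfolding sup_norm_def using M by (intro SUP_least) auto
  then show "(SUP n. sup_norm (g n)) < \<infinity>"
    using less_ereal.simps(4) order_le_less_trans by blast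
qed

lemma eq_0_if_norm_le_geometric:
  fixes v :: "'a::real_normed_vector"
  assumes "\<And>j::nat. norm v \<le> M * r ^ j" "0 \<le> r" "r < 1"
  shows "v = 0"
proof -
  have "(\<lambda>j. M * r ^ j) \<longlonglongrightarrow> M * 0"
    using assms by (intro tendsto_mult_left LIMSEQ_power_zero) auto
  then have "norm v \<le> 0"
    using assms(1) by (intro LIMSEQ_le_const) auto
  then show ?thesis by simp
qed

lemma suminf_eq_head_add:
  fixes f :: "nat \<Rightarrow> 'a::real_normed_vector"
  assumes "summable f"
  shows "suminf f = f 0 + (\<Sum>j. f (Suc j))"
  by (simp add: suminf_split_head[OF assms])

lemma continuous_on_int_times:
  fixes g :: "int \<Rightarrow> 'a::topological_space \<Rightarrow> 'b::topological_space"
  assumes "\<And>n. continuous_on UNIV (g n)"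
  shows "continuous_on UNIV (\<lambda>(n, x). g n x)"
proof -
  have "continuous_on ({n} \<times> UNIV) (\<lambda>(n, x). g n x)" for n
  proof -
    have "continuous_on ({n} \<times> UNIV) (\<lambda>p. g n (snd p))"
      by (rule continuous_on_compose2[OF assms continuous_on_snd]) auto
    then show ?thesis
      by (rule continuous_on_eq) auto
  qed
  then have "continuous_on (\<Union>n. {n} \<times> UNIV) (\<lambda>(n, x). g n x)"
    by (intro continuous_on_open_UN open_Times open_discrete) auto
  moreover have "(\<Union>n. {n} \<times> UNIV) = UNIV" by auto
  ultimately show ?thesis by metis
qed

text \<open>
  The domain is an arbitrary topological space so that the lemma applies to functions of
  \<open>(n, x)\<close>, where the integers \<open>n\<close> carry only their discrete topology and no metric.
\<close>

lemma complete_UNIV_bcontfun: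
  "complete (UNIV :: ('a::topological_space \<Rightarrow>\<^sub>C 'b::complete_space) set)"
  unfolding complete_def
proof (intro allI impI)
  fix f :: "nat \<Rightarrow> 'a \<Rightarrow>\<^sub>C 'b"
  assume "(\<forall>n. f n \<in> UNIV) \<and> Cauchy f"
  then have "uniformly_Cauchy_on UNIV f"
    unfolding uniformly_Cauchy_on_def Cauchy_def by (metis dist_fun_lt_imp_dist_val_lt)
  then obtain g where "uniform_limit UNIV f g sequentially"
    using Cauchy_uniformly_convergent uniformly_convergent_on_def by blast
  then obtain l :: "'a \<Rightarrow>\<^sub>C 'b" where "f \<longlonglongrightarrow> l"
    by (metis uniform_limit_bcontfunE sequentially_bot)
  then show "\<exists>l\<in>UNIV. f \<longlonglongrightarrow> l"
    by blast
qed

lemma homeomorphism_UNIV_imp: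
  assumes "homeomorphism UNIV UNIV F g"
  shows "bij F" "continuous_on UNIV F" "continuous_on UNIV (inv F)"
proof -
  have "inv F = g"
    using assms by (intro inv_equality) (auto simp: homeomorphism_def)
  then show "bij F" "continuous_on UNIV F" "continuous_on UNIV (inv F)"
    using assms
    by (auto simp: homeomorphism_def intro!: bijI inj_on_inverseI[of _ g])
qed

section \<open>Splitting bounded sequences along a generalized dichotomy\<close>

locale generalized_dichotomy =
  fixes A :: "int \<Rightarrow> 'a::banach \<Rightarrow> 'a" and S U :: "int \<Rightarrow> 'a set" and D lam :: real
  assumes invertible: "\<And>n. invertible_operator (A n)"
    and dichotomy: "generalized_exponential_dichotomy A S U D lam"
begin

abbreviation P :: "int \<Rightarrow> 'a \<Rightarrow> 'a" where
  "P n \<equiv> projection_along (S n) (U n)"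

definition rate :: real where
  "rate = exp (- lam)"

text \<open>
  The additional 1 makes \<open>K\<close> bound the complementary projections as well.
\<close>

definition K :: real where
  "K = 1 + (SUP n. onorm (P n))"

text \<open>
  The vectors whose unstable component is mapped by \<open>A n\<close> into \<open>U (n + 1)\<close>.
\<close>

definition E :: "int \<Rightarrow> 'a set" where
  "E n = {s + u | s u. s \<in> S n \<and> u \<in> inv (A n) ` U (n + 1)}"

lemma bij_A: "bij (A n)"
  and bounded_linear_A: "bounded_linear (A n)"
  and bounded_linear_inv_A: "bounded_linear (inv (A n))"
  using invertible by (auto simp: invertible_operator_def)

lemma A_inv_A [simp]: "A n (inv (A n) x) = x" and inv_A_A [simp]: "inv (A n) (A n x) = x"
  using bij_A[of n] by (auto simp: bij_is_surj surj_f_inv_f bij_is_inj inv_f_f)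

lemma rate: "0 < rate" "rate < 1"
  using dichotomy by (auto simp: rate_def generalized_exponential_dichotomy_def)

lemma D_pos: "0 < D"
  using dichotomy by (auto simp: generalized_exponential_dichotomy_def)

lemma A_S: "x \<in> S n \<Longrightarrow> A n x \<in> S (n + 1)"
  and inv_A_U: "y \<in> U (n + 1) \<Longrightarrow> inv (A n) y \<in> U n"
  using dichotomy unfolding generalized_exponential_dichotomy_def by blast+

lemma subspace_S: "subspace (S n)" and subspace_U: "subspace (U n)"
  and S_Int_U: "S n \<inter> U n = {0}"
  and bounded_linear_P: "bounded_linear (P n)"
  and closed_S: "closed (S n)" and closed_U: "closed (U n)"
  using dichotomy by (auto simp: generalized_exponential_dichotomy_def direct_sum_UNIV_def)

lemma ex_splitting: "\<exists>s u. s \<in> S n \<and> u \<in> U n \<and> x = s + u"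
proof -
  have "x \<in> {s + u | s u. s \<in> S n \<and> u \<in> U n}"
    using dichotomy by (auto simp: generalized_exponential_dichotomy_def direct_sum_UNIV_def)
  then show ?thesis by blast
qed

lemma P_eqI:
  assumes "s \<in> S n" "x - s \<in> U n"
  shows "P n x = s"
  unfolding projection_along_def
proof (rule the_equality)
  fix t assume t: "t \<in> S n \<and> x - t \<in> U n"
  have "t - s \<in> S n"
    using t assms subspace_S by (auto intro: subspace_diff)
  moreover have "(x - s) - (x - t) \<in> U n"
    using t assms subspace_U by (blast intro: subspace_diff)
  ultimately have "t - s \<in> S n \<inter> U n" by simp
  then show "t = s" using S_Int_U by auto
qed (use assms in auto)

lemma P_in: "P n x \<in> S n" "x - P n x \<in> U n"
proof -
  obtain s u where su: "s \<in> S n" "u \<in> U n" "x = s + u"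
    using ex_splitting by blast
  then have "P n x = s" by (intro P_eqI) auto
  with su show "P n x \<in> S n" "x - P n x \<in> U n" by auto
qed

lemma norm_P: "norm (P n x) \<le> K * norm x" "norm (x - P n x) \<le> K * norm x"
proof -
  have "onorm (P n) \<le> (SUP n. onorm (P n))"
    using dichotomy by (intro cSUP_upper) (auto simp: generalized_exponential_dichotomy_def)
  then have "onorm (P n) * norm x \<le> (K - 1) * norm x"
    by (intro mult_right_mono) (auto simp: K_def)
  then have P: "norm (P n x) \<le> (K - 1) * norm x"
    using onorm[OF bounded_linear_P[of n], of x] by linarith
  then show "norm (P n x) \<le> K * norm x"
    by (rule order.trans) (auto intro: mult_right_mono)
  show "norm (x - P n x) \<le> K * norm x"
    using P norm_triangle_ineq4[of x "P n x"] by (simp add: algebra_simps)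
qed

lemma K_ge_1: "1 \<le> K"
proof -
  have "0 \<le> onorm (P 0)"
    by (rule onorm_pos_le[OF bounded_linear_P])
  also have "\<dots> \<le> (SUP n. onorm (P n))"
    using dichotomy by (intro cSUP_upper) (auto simp: generalized_exponential_dichotomy_def)
  finally show ?thesis by (simp add: K_def)
qed

lemma exp_eq_rate_power: "exp (- lam * real_of_int (int j)) = rate ^ j"
  by (simp add: rate_def mult.commute flip: exp_of_nat_mult)

lemma cocycle_bound_S:
  assumes "x \<in> S (n - int j)"
  shows "norm (cocycle A n (n - int j) x) \<le> D * rate ^ j * norm x"
proof -
  have "\<forall>m n. \<forall>x\<in>S n. m \<ge> n \<longrightarrow>
      norm (cocycle A m n x) \<le> D * exp (- lam * real_of_int (m - n)) * norm x"
    using dichotomy unfolding generalized_exponential_dichotomy_def by (elim conjE)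
  from this[rule_format, OF assms, of n] show ?thesis
    by (simp only: diff_diff_eq2 add_diff_cancel_left' exp_eq_rate_power)
qed

lemma cocycle_bound_U:
  assumes "x \<in> U (n + int j)"
  shows "norm (cocycle A n (n + int j) x) \<le> D * rate ^ j * norm x"
proof -
  have "\<forall>m n. \<forall>x\<in>U n. m \<le> n \<longrightarrow>
      norm (cocycle A m n x) \<le> D * exp (- lam * real_of_int (n - m)) * norm x"
    using dichotomy unfolding generalized_exponential_dichotomy_def by (elim conjE)
  from this[rule_format, OF assms, of n] show ?thesis
    by (simp only: add_diff_cancel_left' exp_eq_rate_power)
qed

lemma cocycle_S: "x \<in> S (n - int j) \<Longrightarrow> cocycle A n (n - int j) x \<in> S n"
proof (induction j arbitrary: n)
  case (Suc j)
  have eq: "n - int (Suc j) = n - 1 - int j"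
    by simp
  have "cocycle A (n - 1) (n - 1 - int j) x \<in> S (n - 1)"
    using Suc.prems unfolding eq by (rule Suc.IH)
  then show ?case
    unfolding eq using cocycle_step[of A, OF bij_A, of "n - 1" "n - 1 - int j" x] A_S[of _ "n - 1"]
    by simp
qed simp

lemma cocycle_U: "x \<in> U (n + int j) \<Longrightarrow> cocycle A n (n + int j) x \<in> U n"
proof (induction j arbitrary: n)
  case (Suc j)
  have eq: "n + int (Suc j) = n + 1 + int j"
    by simp
  have "cocycle A (n + 1) (n + 1 + int j) x \<in> U (n + 1)"
    using Suc.prems unfolding eq by (rule Suc.IH)
  then have "inv (A n) (cocycle A (n + 1) (n + 1 + int j) x) \<in> U n"
    by (rule inv_A_U)
  then show ?case
    unfolding eq by (simp only: cocycle_step[of A, OF bij_A] inv_A_A)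
qed simp

lemma inv_A_image_U_subset: "inv (A n) ` U (n + 1) \<subseteq> U n"
  using inv_A_U by blast

lemma subspace_inv_A_image_U: "subspace (inv (A n) ` U (n + 1))"
  by (intro linear_subspace_image bounded_linear.linear bounded_linear_inv_A subspace_U)

lemma closed_inv_A_image_U: "closed (inv (A n) ` U (n + 1))"
proof -
  have "inv (A n) ` U (n + 1) = A n -` U (n + 1)"
    using bij_A by (simp add: bij_vimage_eq_inv_image)
  then show ?thesis
    using closed_U bounded_linear_A
    by (simp add: closed_vimage linear_continuous_on)
qed

lemma subspace_E: "subspace (E n)"
  unfolding E_def by (rule subspace_sums[OF subspace_S subspace_inv_A_image_U])

text \<open>
  On \<open>E n\<close> the two components of a vector are mapped by \<open>A n\<close> into \<open>S (n + 1)\<close> and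
  \<open>U (n + 1)\<close>, so both components of an orbit of \<open>A\<close> that stays in \<open>E\<close> are orbits themselves.
  The stable one is small because it has been contracted since the remote past, the unstable one
  because it is the contracted preimage of a bounded vector in the remote future.  Off \<open>E\<close> this
  fails: \<open>A n\<close> may map vectors of \<open>U n\<close> out of \<open>U (n + 1)\<close>.
\<close>

lemma bounded_orbit_in_E_eq_0:
  assumes orbit: "\<And>n. w (n + 1) = A n (w n)" and E: "\<And>n. w n \<in> E n"
    and bounded: "\<And>n. norm (w n) \<le> B"
  shows "w n = 0"
proof -
  define s where "s n = P n (w n)" for n
  define u where "u n = w n - P n (w n)" for n
  have u_in: "u n \<in> inv (A n) ` U (n + 1)" for n
  proof -
    obtain s' u' where *: "w n = s' + u'" "s' \<in> S n" "u' \<in> inv (A n) ` U (n + 1)"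
      using E[of n] by (auto simp: E_def)
    then have "P n (w n) = s'"
      using inv_A_image_U_subset by (intro P_eqI) auto
    with * show ?thesis by (simp add: u_def)
  qed
  have orbit_s: "s (n + 1) = A n (s n)" for n
  proof -
    have "A n (w n) - A n (s n) = A n (u n)"
      using bounded_linear_A by (simp add: s_def u_def linear_diff bounded_linear.linear)
    also have "\<dots> \<in> U (n + 1)"
      using u_in[of n] by auto
    finally show ?thesis
      unfolding s_def orbit by (intro P_eqI A_S P_in) (auto simp: s_def)
  qed
  have orbit_u: "u (n + 1) = A n (u n)" for n
    using orbit_s[of n] bounded_linear_A[of n]
    by (simp add: s_def u_def orbit linear_diff bounded_linear.linear)
  have B: "norm (s n) \<le> K * B" "norm (u n) \<le> K * B" for n
    using norm_P(1)[of n "w n"] norm_P(2)[of "w n" n] K_ge_1 mult_left_mono[OF bounded[of n], of K]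
    unfolding s_def u_def by linarith+
  have "s n = 0"
  proof (rule eq_0_if_norm_le_geometric)
    fix j
    have "norm (s n) = norm (cocycle A n (n - int j) (s (n - int j)))"
      by (simp add: cocycle_orbit[where F = A and v = s, OF bij_A orbit_s])
    also have "\<dots> \<le> D * rate ^ j * norm (s (n - int j))"
      by (rule cocycle_bound_S) (simp add: s_def P_in)
    also have "\<dots> \<le> D * rate ^ j * (K * B)"
      using D_pos rate B by (intro mult_left_mono) auto
    finally show "norm (s n) \<le> (D * (K * B)) * rate ^ j"
      by (simp add: mult_ac)
  qed (use rate in auto)
  moreover have "u n = 0"
  proof (rule eq_0_if_norm_le_geometric)
    fix j
    have "norm (u n) = norm (cocycle A n (n + int j) (u (n + int j)))"
      by (simp add: cocycle_orbit[where F = A and v = u, OF bij_A orbit_u])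
    also have "\<dots> \<le> D * rate ^ j * norm (u (n + int j))"
      by (rule cocycle_bound_U) (simp add: u_def P_in)
    also have "\<dots> \<le> D * rate ^ j * (K * B)"
      using D_pos rate B by (intro mult_left_mono) auto
    finally show "norm (u n) \<le> (D * (K * B)) * rate ^ j"
      by (simp add: mult_ac)
  qed (use rate in auto)
  ultimately show ?thesis
    by (simp add: s_def u_def)
qed

section \<open>The Green operator\<close>

definition stable_term :: "int \<Rightarrow> (int \<Rightarrow> 'a) \<Rightarrow> nat \<Rightarrow> 'a" where
  "stable_term n y j = cocycle A n (n - int j) (P (n - int j) (y (n - int j)))"

definition unstable_term :: "int \<Rightarrow> (int \<Rightarrow> 'a) \<Rightarrow> nat \<Rightarrow> 'a" where
  "unstable_term n y j =
     cocycle A n (n + 1 + int j) (y (n + 1 + int j) - P (n + 1 + int j) (y (n + 1 + int j)))"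

text \<open>
  The bounded solution in \<open>E\<close> of \<open>x (n + 1) = A n (x n) + y (n + 1)\<close>: the stable part of the forcing is
  summed over the past, the unstable part over the future.
\<close>

definition green :: "int \<Rightarrow> (int \<Rightarrow> 'a) \<Rightarrow> 'a" where
  "green n y = (\<Sum>j. stable_term n y j) - (\<Sum>j. unstable_term n y j)"

definition green_const :: real where
  "green_const = 2 * D * K / (1 - rate)"

lemma green_const_pos: "0 < green_const"
  using D_pos K_ge_1 rate by (simp add: green_const_def)

context
  fixes y :: "int \<Rightarrow> 'a" and M :: real
  assumes y: "\<And>n. norm (y n) \<le> M"
begin

lemma norm_stable_term: "norm (stable_term n y j) \<le> D * K * M * rate ^ j"
proof -
  have "norm (stable_term n y j) \<le> D * rate ^ j * norm (P (n - int j) (y (n - int j)))"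
    unfolding stable_term_def by (rule cocycle_bound_S) (rule P_in)
  also have "\<dots> \<le> D * rate ^ j * (K * M)"
    using D_pos rate K_ge_1 y
    by (intro mult_left_mono order.trans[OF norm_P(1)]) auto
  finally show ?thesis by (simp add: mult_ac)
qed

lemma norm_unstable_term: "norm (unstable_term n y j) \<le> D * K * M * rate ^ j"
proof -
  define k where "k = n + 1 + int j"
  have k: "k = n + int (Suc j)" by (simp add: k_def)
  have "norm (unstable_term n y j) \<le> D * rate ^ Suc j * norm (y k - P k (y k))"
    unfolding unstable_term_def k_def[symmetric] unfolding k
    by (rule cocycle_bound_U) (rule P_in)
  also have "\<dots> \<le> D * rate ^ Suc j * (K * M)"
    using D_pos rate K_ge_1 y
    by (intro mult_left_mono order.trans[OF norm_P(2)]) auto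
  also have "\<dots> \<le> D * rate ^ j * (K * M)"
    using D_pos rate K_ge_1 order.trans[OF norm_ge_zero y]
    by (intro mult_right_mono mult_left_mono power_decreasing) auto
  finally show ?thesis by (simp add: mult_ac)
qed

lemma summable_bound: "summable (\<lambda>j. D * K * M * rate ^ j)"
  using rate by (intro summable_mult summable_geometric) auto

lemma summable_stable_term: "summable (stable_term n y)"
  by (rule summable_comparison_test'[OF summable_bound norm_stable_term])

lemma summable_unstable_term: "summable (unstable_term n y)"
  by (rule summable_comparison_test'[OF summable_bound norm_unstable_term])

lemma norm_green: "norm (green n y) \<le> green_const * M"
proof -
  have sums: "(\<Sum>j. D * K * M * rate ^ j) = D * K * M / (1 - rate)"
    using rate by (simp add: suminf_mult suminf_geometric summable_geometric)
  have "norm (\<Sum>j. stable_term n y j) \<le> (\<Sum>j. D * K * M * rate ^ j)"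
    using norm_stable_term summable_bound by (intro norm_suminf_le) auto
  moreover have "norm (\<Sum>j. unstable_term n y j) \<le> (\<Sum>j. D * K * M * rate ^ j)"
    using norm_unstable_term summable_bound by (intro norm_suminf_le) auto
  moreover have "D * K * M / (1 - rate) + D * K * M / (1 - rate) = 2 * D * K / (1 - rate) * M"
    by simp
  ultimately show ?thesis
    using norm_triangle_ineq4[of "\<Sum>j. stable_term n y j" "\<Sum>j. unstable_term n y j"]
    unfolding green_def sums green_const_def by linarith
qed

lemma green_in_E: "green n y \<in> E n"
proof -
  have "(\<Sum>j. stable_term n y j) \<in> S n"
  proof (rule closed_sequentially[OF closed_S])
    show "(\<lambda>k. \<Sum>j<k. stable_term n y j) \<longlonglongrightarrow> (\<Sum>j. stable_term n y j)"
      by (rule summable_LIMSEQ[OF summable_stable_term])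
    show "(\<Sum>j<k. stable_term n y j) \<in> S n" for k
      by (auto intro!: subspace_sum subspace_S simp: stable_term_def cocycle_S P_in)
  qed
  moreover have "(\<Sum>j. unstable_term n y j) \<in> inv (A n) ` U (n + 1)"
  proof (rule closed_sequentially[OF closed_inv_A_image_U])
    show "(\<lambda>k. \<Sum>j<k. unstable_term n y j) \<longlonglongrightarrow> (\<Sum>j. unstable_term n y j)"
      by (rule summable_LIMSEQ[OF summable_unstable_term])
    have "unstable_term n y j \<in> inv (A n) ` U (n + 1)" for j
    proof
      show "A n (unstable_term n y j) \<in> U (n + 1)"
        unfolding unstable_term_def cocycle_step[of A, OF bij_A, symmetric]
        by (intro cocycle_U P_in)
    qed simp
    then show "(\<Sum>j<k. unstable_term n y j) \<in> inv (A n) ` U (n + 1)" for k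
      by (auto intro!: subspace_sum subspace_inv_A_image_U)
  qed
  then have "- (\<Sum>j. unstable_term n y j) \<in> inv (A n) ` U (n + 1)"
    by (rule subspace_neg[OF subspace_inv_A_image_U])
  ultimately have "(\<Sum>j. stable_term n y j) + - (\<Sum>j. unstable_term n y j) \<in> E n"
    unfolding E_def by blast
  then show ?thesis
    by (simp add: green_def)
qed

text \<open>
  Passing from \<open>n\<close> to \<open>n + 1\<close> moves the index \<open>n + 1\<close> from the future sum to the past sum; the
  two components of \<open>y (n + 1)\<close> thereby add up to \<open>y (n + 1)\<close> itself.
\<close>

lemma green_step: "green (n + 1) y = A n (green n y) + y (n + 1)"
proof -
  have st: "stable_term (n + 1) y (Suc j) = A n (stable_term n y j)" for j
  proof -
    have eq: "n + 1 - int (Suc j) = n - int j"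
      by simp
    show ?thesis
      unfolding stable_term_def eq by (rule cocycle_step[of A, OF bij_A])
  qed
  have un: "A n (unstable_term n y (Suc j)) = unstable_term (n + 1) y j" for j
  proof -
    have eq: "n + 1 + int (Suc j) = n + 1 + 1 + int j"
      by simp
    show ?thesis
      unfolding unstable_term_def eq by (rule cocycle_step[of A, OF bij_A, symmetric])
  qed
  have "(\<Sum>j. stable_term (n + 1) y j) = stable_term (n + 1) y 0 + (\<Sum>j. A n (stable_term n y j))"
    using suminf_eq_head_add[OF summable_stable_term[of "n + 1"]] unfolding st .
  moreover have "(\<Sum>j. A n (stable_term n y j)) = A n (\<Sum>j. stable_term n y j)"
    by (rule bounded_linear.suminf[OF bounded_linear_A[of n] summable_stable_term[of n], symmetric])
  moreover have "stable_term (n + 1) y 0 = P (n + 1) (y (n + 1))"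
    by (simp add: stable_term_def)
  ultimately have 1: "(\<Sum>j. stable_term (n + 1) y j) =
      P (n + 1) (y (n + 1)) + A n (\<Sum>j. stable_term n y j)"
    by (simp only:)
  have "A n (\<Sum>j. unstable_term n y j) = (\<Sum>j. A n (unstable_term n y j))"
    by (rule bounded_linear.suminf[OF bounded_linear_A[of n] summable_unstable_term[of n]])
  moreover have "(\<Sum>j. A n (unstable_term n y j)) =
      A n (unstable_term n y 0) + (\<Sum>j. unstable_term (n + 1) y j)"
    using suminf_eq_head_add[OF bounded_linear.summable[OF bounded_linear_A[of n] summable_unstable_term[of n]]]
    unfolding un .
  moreover have "A n (unstable_term n y 0) = y (n + 1) - P (n + 1) (y (n + 1))"
    by (simp add: unstable_term_def cocycle_step[of A, OF bij_A, of n "n + 1", symmetric])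
  ultimately have 2: "A n (\<Sum>j. unstable_term n y j) =
      y (n + 1) - P (n + 1) (y (n + 1)) + (\<Sum>j. unstable_term (n + 1) y j)"
    by (simp only:)
  have "A n (green n y) = A n (\<Sum>j. stable_term n y j) - A n (\<Sum>j. unstable_term n y j)"
    unfolding green_def by (rule linear_diff[OF bounded_linear.linear[OF bounded_linear_A]])
  then show ?thesis
    unfolding 2 unfolding green_def 1 by simp
qed

end

lemma green_diff:
  assumes y: "\<And>n. norm (y n) \<le> M" and z: "\<And>n. norm (z n) \<le> N"
  shows "green n y - green n z = green n (\<lambda>k. y k - z k)"
proof -
  note lin = linear_diff[OF bounded_linear.linear, OF bounded_linear_cocycle[of A, OF bounded_linear_A bounded_linear_inv_A]]
    linear_diff[OF bounded_linear.linear, OF bounded_linear_P]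
  have st: "stable_term n (\<lambda>k. y k - z k) j = stable_term n y j - stable_term n z j" for j
    by (simp add: stable_term_def lin)
  have un: "unstable_term n (\<lambda>k. y k - z k) j = unstable_term n y j - unstable_term n z j" for j
    by (simp only: unstable_term_def lin) (simp add: algebra_simps)
  note diffs = suminf_diff[OF summable_stable_term[where y = y and n = n, OF y]
      summable_stable_term[where y = z and n = n, OF z]]
    suminf_diff[OF summable_unstable_term[where y = y and n = n, OF y]
      summable_unstable_term[where y = z and n = n, OF z]]
  show ?thesis
    unfolding green_def st un diffs[symmetric] by simp
qed

text \<open>
  The bound on the terms of the two series is uniform in \<open>x\<close>, so the series converge uniformly.
\<close>

lemma continuous_on_green:
  fixes Y :: "int \<Rightarrow> 'b::topological_space \<Rightarrow> 'a"
  assumes cont: "\<And>k. continuous_on UNIV (Y k)" and bound: "\<And>k x. norm (Y k x) \<le> M"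
  shows "continuous_on UNIV (\<lambda>x. green n (\<lambda>k. Y k x))"
proof -
  note lin = bounded_linear.continuous_on[OF bounded_linear_cocycle[of A, OF bounded_linear_A bounded_linear_inv_A]]
    bounded_linear.continuous_on[OF bounded_linear_P]
  have "continuous_on UNIV (\<lambda>x. \<Sum>j. stable_term n (\<lambda>k. Y k x) j)"
  proof (rule uniform_limit_theorem)
    show "uniform_limit UNIV (\<lambda>k x. \<Sum>j<k. stable_term n (\<lambda>k. Y k x) j)
        (\<lambda>x. \<Sum>j. stable_term n (\<lambda>k. Y k x) j) sequentially"
      by (rule Weierstrass_m_test[OF norm_stable_term summable_bound[of _ M]]) (use bound in auto)
    show "\<forall>\<^sub>F k in sequentially. continuous_on UNIV (\<lambda>x. \<Sum>j<k. stable_term n (\<lambda>k. Y k x) j)"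
      unfolding stable_term_def by (intro always_eventually allI continuous_on_sum lin cont)
  qed simp
  moreover have "continuous_on UNIV (\<lambda>x. \<Sum>j. unstable_term n (\<lambda>k. Y k x) j)"
  proof (rule uniform_limit_theorem)
    show "uniform_limit UNIV (\<lambda>k x. \<Sum>j<k. unstable_term n (\<lambda>k. Y k x) j)
        (\<lambda>x. \<Sum>j. unstable_term n (\<lambda>k. Y k x) j) sequentially"
      by (rule Weierstrass_m_test[OF norm_unstable_term summable_bound[of _ M]]) (use bound in auto)
    show "\<forall>\<^sub>F k in sequentially. continuous_on UNIV (\<lambda>x. \<Sum>j<k. unstable_term n (\<lambda>k. Y k x) j)"
      unfolding unstable_term_def
      by (intro always_eventually allI continuous_on_sum continuous_on_diff lin cont)
  qed simp
  ultimately show ?thesis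
    unfolding green_def by (rule continuous_on_diff)
qed

text \<open>
  The difference between \<open>v\<close> and the Green solution with forcing \<open>d\<close> is a bounded orbit in \<open>E\<close>,
  hence zero.  So \<open>v\<close> is bounded by \<open>green_const\<close> times the size of \<open>d\<close>, that is, by half of any
  bound on \<open>v\<close>.
\<close>

lemma bounded_perturbed_orbit_in_E_eq_0:
  assumes step: "\<And>n. v (n + 1) = A n (v n) + d n" and E: "\<And>n. v n \<in> E n"
    and bounded: "\<And>n. norm (v n) \<le> B"
    and small: "\<And>n. norm (d n) \<le> norm (v n) / (2 * green_const)"
  shows "v n = 0"
proof -
  \<comment> \<open>Any bound can be halved, so repeating this step drives it to zero.\<close>
  have half: "norm (v n) \<le> B / 2" if B: "\<And>n. norm (v n) \<le> B" for B n
  proof -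
    define y where "y k = d (k - 1)" for k
    have y: "norm (y k) \<le> B / (2 * green_const)" for k
      unfolding y_def using small[of "k - 1"] B[of "k - 1"] green_const_pos
      by (smt (verit) divide_right_mono)
    have "v n - green n y = 0"
    proof (rule bounded_orbit_in_E_eq_0[where w = "\<lambda>n. v n - green n y"])
      show "v (n + 1) - green (n + 1) y = A n (v n - green n y)" for n
        using bounded_linear_A
        by (simp add: step green_step[where y = y, OF y] linear_diff bounded_linear.linear) (simp add: y_def)
      show "v n - green n y \<in> E n" for n
        by (intro subspace_diff subspace_E E green_in_E[where y = y, OF y])
      show "norm (v n - green n y) \<le> B + green_const * (B / (2 * green_const))" for n
        using norm_triangle_ineq4[of "v n" "green n y"] B[of n] norm_green[where y = y, OF y, of n] by linarith
    qed
    then show ?thesis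
      using norm_green[where y = y, OF y, of n] green_const_pos by simp
  qed
  have "norm (v n) \<le> B / 2 ^ j" for n j
  proof (induction j arbitrary: n)
    case 0
    then show ?case using bounded by simp
  next
    case (Suc j)
    then show ?case using half[of "B / 2 ^ j"] by (simp add: mult.commute)
  qed
  then show ?thesis
    by (intro eq_0_if_norm_le_geometric[where M = B and r = "1 / 2"]) (auto simp: power_divide)
qed

section \<open>Conjugacies between small perturbations\<close>

text \<open>
  The Lipschitz constant is chosen so that composing the nonlinear part with the Green operator,
  whose norm is at most \<open>green_const\<close>, gives a contraction with factor one half.
\<close>

definition small_perturbation :: "(int \<Rightarrow> 'a \<Rightarrow> 'a) \<Rightarrow> bool" where
  "small_perturbation F \<longleftrightarrow>
     (\<forall>n. bij (F n) \<and> continuous_on UNIV (F n) \<and> continuous_on UNIV (inv (F n))) \<and>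
     (\<exists>M. \<forall>n x. norm (F n x - A n x) \<le> M) \<and>
     (\<forall>n x y. norm ((F n x - A n x) - (F n y - A n y)) \<le> norm (x - y) / (2 * green_const))"

definition conjugacy :: "(int \<Rightarrow> 'a \<Rightarrow> 'a) \<Rightarrow> (int \<Rightarrow> 'a \<Rightarrow> 'a) \<Rightarrow> (int \<Rightarrow> 'a \<Rightarrow> 'a) \<Rightarrow> bool" where
  "conjugacy F G H \<longleftrightarrow>
     (\<forall>n x. H (n + 1) (F n x) = G n (H n x)) \<and>
     (\<exists>M. \<forall>n x. norm (H n x - x) \<le> M) \<and>
     (\<forall>n x. H n x - x \<in> E n)"

lemma small_perturbation_self: "small_perturbation A"
  unfolding small_perturbation_def
  using bij_A bounded_linear_A bounded_linear_inv_A green_const_pos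
  by (auto simp: linear_continuous_on intro!: exI[of _ 0])

lemma conjugacy_id: "conjugacy F F (\<lambda>n x. x)"
  unfolding conjugacy_def by (auto intro!: exI[of _ 0] subspace_0[OF subspace_E])

lemma conjugacy_compose:
  assumes H: "conjugacy F F' H" and H': "conjugacy F' F'' H'"
  shows "conjugacy F F'' (\<lambda>n x. H' n (H n x))"
proof -
  obtain M M' where M: "\<And>n x. norm (H n x - x) \<le> M" and M': "\<And>n x. norm (H' n x - x) \<le> M'"
    using H H' unfolding conjugacy_def by blast
  have split: "H' n (H n x) - x = (H' n (H n x) - H n x) + (H n x - x)" for n x
    by simp
  have "norm (H' n (H n x) - x) \<le> M' + M" for n x
    unfolding split by (rule norm_triangle_le) (use M M' in \<open>auto intro: add_mono\<close>)
  moreover have "H' n (H n x) - x \<in> E n" for n x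
    unfolding split by (rule subspace_add[OF subspace_E]) (use H H' in \<open>auto simp: conjugacy_def\<close>)
  ultimately show ?thesis
    using H H' unfolding conjugacy_def by auto
qed

text \<open>
  Along one orbit of \<open>F\<close>, the difference of two conjugacies is a perturbed orbit in \<open>E\<close>, with
  perturbation controlled by the Lipschitz constant of the nonlinear part of \<open>G\<close>.
\<close>

lemma conjugacy_unique:
  assumes F: "\<And>n. bij (F n)" and G: "small_perturbation G"
    and H: "conjugacy F G H" and H': "conjugacy F G H'"
  shows "H n x = H' n x"
proof -
  define t where "t k = cocycle F k n x" for k
  define v where "v k = H k (t k) - H' k (t k)" for k
  define d where "d k = (G k (H k (t k)) - A k (H k (t k))) - (G k (H' k (t k)) - A k (H' k (t k)))" for k
  obtain M M' where M: "\<And>n x. norm (H n x - x) \<le> M" and M': "\<And>n x. norm (H' n x - x) \<le> M'"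
    using H H' unfolding conjugacy_def by blast
  have v: "v k = (H k (t k) - t k) - (H' k (t k) - t k)" for k
    by (simp add: v_def)
  have "v n = 0"
  proof (rule bounded_perturbed_orbit_in_E_eq_0[where v = v and d = d and B = "M + M'"])
    have "t (k + 1) = F k (t k)" for k
      unfolding t_def by (rule cocycle_step[of F, OF F])
    then show "v (k + 1) = A k (v k) + d k" for k
      using H H' bounded_linear_A
      by (simp add: v_def d_def conjugacy_def linear_diff bounded_linear.linear)
    show "v k \<in> E k" for k
      unfolding v by (rule subspace_diff[OF subspace_E]) (use H H' in \<open>auto simp: conjugacy_def\<close>)
    show "norm (v k) \<le> M + M'" for k
      unfolding v using norm_triangle_ineq4 M M' by (meson add_mono order.trans)
    show "norm (d k) \<le> norm (v k) / (2 * green_const)" for k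
      using G by (auto simp: small_perturbation_def d_def v_def)
  qed
  then show ?thesis by (simp add: v_def t_def)
qed

text \<open>
  Writing \<open>H n x = x + h n x\<close>, conjugating \<open>F\<close> to \<open>G\<close> means that along every orbit of \<open>F\<close> the
  sequence \<open>h\<close> solves the linear equation of the Green operator with a forcing that depends
  on \<open>h\<close> itself.  This is a fixed point equation for a contraction with factor one half on
  the bounded continuous functions of \<open>(n, x)\<close>, where the integers are discrete.
\<close>

lemma ex_continuous_conjugacy:
  assumes F: "small_perturbation F" and G: "small_perturbation G"
  shows "\<exists>H. conjugacy F G H \<and> (\<forall>n. continuous_on UNIV (H n))"
proof -
  have bij: "\<And>n. bij (F n)" and contF: "\<And>n. continuous_on UNIV (F n)"
    and contF': "\<And>n. continuous_on UNIV (inv (F n))" and contG: "\<And>n. continuous_on UNIV (G n)"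
    using F G by (auto simp: small_perturbation_def)
  obtain M N where M: "\<And>n x. norm (F n x - A n x) \<le> M" and N: "\<And>n x. norm (G n x - A n x) \<le> N"
    using F G unfolding small_perturbation_def by blast
  have lip: "norm ((G n x - A n x) - (G n y - A n y)) \<le> norm (x - y) / (2 * green_const)" for n x y
    using G by (simp add: small_perturbation_def)
  have contA: "continuous_on UNIV (A n)" for n
    by (rule linear_continuous_on[OF bounded_linear_A])
  define forcing :: "((int \<times> 'a) \<Rightarrow>\<^sub>C 'a) \<Rightarrow> int \<Rightarrow> 'a \<Rightarrow> 'a" where
    "forcing h k x = (G k (x + h (k, x)) - A k (x + h (k, x))) - (F k x - A k x)" for h k x
  \<comment> \<open>The Green operator at \<open>n\<close> takes as forcing the values met along the orbit of \<open>F\<close> through \<open>x\<close>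
      at time \<open>n\<close>; the forcing at index \<open>k\<close> comes from time \<open>k - 1\<close>.\<close>
  define Y :: "((int \<times> 'a) \<Rightarrow>\<^sub>C 'a) \<Rightarrow> int \<Rightarrow> int \<Rightarrow> 'a \<Rightarrow> 'a" where
    "Y h n k x = forcing h (k - 1) (cocycle F (k - 1) n x)" for h n k x
  have bound: "norm (Y h n k x) \<le> N + M" for h n k x
    unfolding Y_def forcing_def using norm_triangle_ineq4 M N by (meson add_mono order.trans)
  have cont_h: "continuous_on UNIV (\<lambda>x. apply_bcontfun h (k, x))" for h :: "(int \<times> 'a) \<Rightarrow>\<^sub>C 'a" and k
    by (rule continuous_on_compose2[OF continuous_on_apply_bcontfun[of UNIV h]])
      (auto intro!: continuous_intros)
  have cont_forcing: "continuous_on UNIV (forcing h k)" for h k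
    unfolding forcing_def
    by (intro continuous_on_diff continuous_on_add continuous_on_id cont_h contF contA
        continuous_on_compose2[OF contG] continuous_on_compose2[OF contA]) auto
  have cont_Y: "continuous_on UNIV (Y h n k)" for h n k
    unfolding Y_def
    by (rule continuous_on_compose2[OF cont_forcing continuous_on_cocycle[of F, OF contF contF']]) auto
  define T where "T h = Bcontfun (\<lambda>(n, x). green n (\<lambda>k. Y h n k x))" for h
  have T: "apply_bcontfun (T h) (n, x) = green n (\<lambda>k. Y h n k x)" for h n x
  proof -
    have "(\<lambda>(n, x). green n (\<lambda>k. Y h n k x)) \<in> bcontfun"
    proof (rule bcontfun_normI)
      show "continuous_on UNIV (\<lambda>(n, x). green n (\<lambda>k. Y h n k x))"
        by (intro continuous_on_int_times continuous_on_green[where M = "N + M"] cont_Y bound)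
      show "norm (case p of (n, x) \<Rightarrow> green n (\<lambda>k. Y h n k x)) \<le> green_const * (N + M)" for p
        by (cases p) (auto intro!: norm_green bound)
    qed
    then show ?thesis
      by (simp add: T_def Bcontfun_inverse)
  qed
  have "\<exists>!h\<in>UNIV. T h = h"
  proof (rule Banach_fix[OF complete_UNIV_bcontfun])
    show "dist (T h) (T g) \<le> 1 / 2 * dist h g" for h g
    proof (rule dist_bound)
      fix p :: "int \<times> 'a"
      obtain n x where p: "p = (n, x)" by (cases p)
      have *: "norm (Y h n k x - Y g n k x) \<le> dist h g / (2 * green_const)" for k
      proof -
        define t where "t = cocycle F (k - 1) n x"
        have diff: "Y h n k x - Y g n k x =
            (G (k - 1) (t + h (k - 1, t)) - A (k - 1) (t + h (k - 1, t))) -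
            (G (k - 1) (t + g (k - 1, t)) - A (k - 1) (t + g (k - 1, t)))"
          by (simp add: Y_def forcing_def t_def)
        have "norm (Y h n k x - Y g n k x) \<le>
            norm ((t + h (k - 1, t)) - (t + g (k - 1, t))) / (2 * green_const)"
          unfolding diff by (rule lip)
        also have "\<dots> \<le> dist h g / (2 * green_const)"
          using dist_bounded[of h "(k - 1, t)" g] green_const_pos
          by (intro divide_right_mono) (auto simp: dist_norm)
        finally show ?thesis .
      qed
      have "dist (T h p) (T g p) = norm (green n (\<lambda>k. Y h n k x - Y g n k x))"
        by (simp add: p T dist_norm green_diff[where y = "\<lambda>k. Y h n k x" and z = "\<lambda>k. Y g n k x", OF bound bound])
      also have "\<dots> \<le> green_const * (dist h g / (2 * green_const))"
        by (rule norm_green[where y = "\<lambda>k. Y h n k x - Y g n k x", OF *])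
      also have "\<dots> = 1 / 2 * dist h g"
        using green_const_pos by simp
      finally show "dist (T h p) (T g p) \<le> 1 / 2 * dist h g" .
    qed
  qed auto
  then obtain h where "T h = h" by blast
  then have h: "apply_bcontfun h (n, x) = green n (\<lambda>k. Y h n k x)" for n x
    using T[of h n x] by simp
  define H where "H n x = x + h (n, x)" for n x
  \<comment> \<open>The points \<open>(n, x)\<close> and \<open>(n + 1, F n x)\<close> lie on the same orbit, so they see the same forcing.\<close>
  have step: "h (n + 1, F n x) = A n (h (n, x)) + forcing h n x" for n x
  proof -
    have "Y h (n + 1) k (F n x) = Y h n k x" for k
      by (simp add: Y_def cocycle_shift[of F, OF bij])
    then have "h (n + 1, F n x) = green (n + 1) (\<lambda>k. Y h n k x)"
      by (simp add: h)
    also have "\<dots> = A n (h (n, x)) + Y h n (n + 1) x"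
      by (subst green_step[where y = "\<lambda>k. Y h n k x", OF bound]) (simp add: h)
    finally show ?thesis
      by (simp add: Y_def)
  qed
  have "conjugacy F G H"
    unfolding conjugacy_def
  proof (intro conjI allI exI)
    fix n x
    show "H (n + 1) (F n x) = G n (H n x)"
      using linear_add[OF bounded_linear.linear, OF bounded_linear_A, of n x "h (n, x)"]
      by (simp add: H_def step forcing_def)
    show "norm (H n x - x) \<le> green_const * (N + M)"
      using norm_green[where y = "\<lambda>k. Y h n k x", OF bound] by (simp add: H_def h)
    show "H n x - x \<in> E n"
      using green_in_E[where y = "\<lambda>k. Y h n k x", OF bound] by (simp add: H_def h)
  qed
  moreover have "continuous_on UNIV (H n)" for n
    unfolding H_def by (intro continuous_intros cont_h)
  ultimately show ?thesis by blast
qed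

text \<open>
  Conjugacies exist in both directions, and by uniqueness both compositions are the identity.
\<close>

lemma conjugacy_homeomorphism:
  assumes F: "small_perturbation F" and G: "small_perturbation G"
  obtains H where "conjugacy F G H" "\<And>n. \<exists>g. homeomorphism UNIV UNIV (H n) g"
proof -
  obtain H where H: "conjugacy F G H" "\<And>n. continuous_on UNIV (H n)"
    using ex_continuous_conjugacy[OF F G] by blast
  obtain H' where H': "conjugacy G F H'" "\<And>n. continuous_on UNIV (H' n)"
    using ex_continuous_conjugacy[OF G F] by blast
  have bij: "\<And>n. bij (F n)" "\<And>n. bij (G n)"
    using F G by (auto simp: small_perturbation_def)
  have "H' n (H n x) = x" for n x
    by (rule conjugacy_unique[OF bij(1) F conjugacy_compose[OF H(1) H'(1)] conjugacy_id])
  moreover have "H n (H' n x) = x" for n x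
    by (rule conjugacy_unique[OF bij(2) G conjugacy_compose[OF H'(1) H(1)] conjugacy_id])
  ultimately have "homeomorphism UNIV UNIV (H n) (H' n)" for n
    using H(2) H'(2) by (intro homeomorphismI) auto
  then show ?thesis
    using that H(1) by blast
qed

lemma small_perturbation_add:
  assumes lip: "\<forall>n x y. norm (f n x - f n y) \<le> c * norm (x - y)"
    and c: "c \<le> 1 / (2 * green_const)"
    and homeo: "\<forall>n. \<exists>g. homeomorphism UNIV UNIV (\<lambda>x. A n x + f n x) g"
    and bounded: "(SUP n. sup_norm (f n)) < \<infinity>"
  shows "small_perturbation (\<lambda>n x. A n x + f n x)"
proof -
  have "norm (f n x - f n y) \<le> norm (x - y) / (2 * green_const)" for n x y
    using lip[rule_format, of n x y] mult_right_mono[OF c norm_ge_zero[of "x - y"]] by simp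
  then show ?thesis
    unfolding small_perturbation_def
    using bounded[unfolded SUP_sup_norm_less_infinity_iff] homeo homeomorphism_UNIV_imp by simp blast
qed

lemma conjugacy_iff:
  "conjugacy F G H \<longleftrightarrow>
     (\<forall>n. H (n + 1) \<circ> F n = G n \<circ> H n) \<and>
     (SUP n. sup_norm (\<lambda>x. H n x - x)) < \<infinity> \<and>
     (\<forall>n x. H n x - x \<in> {s + u | s u. s \<in> S n \<and> u \<in> inv (A n) ` U (n + 1)})"
  unfolding conjugacy_def E_def SUP_sup_norm_less_infinity_iff fun_eq_iff by simp

end

theorem theorem1:
  fixes A :: "int \<Rightarrow> 'a::banach \<Rightarrow> 'a"
    and S U :: "int \<Rightarrow> 'a set"
    and D lam :: real
  assumes "\<And>n. invertible_operator (A n)"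
    and "generalized_exponential_dichotomy A S U D lam"
  shows "\<exists>c0>0. \<forall>c::real. 0 < c \<and> c \<le> c0 \<longrightarrow>
    (\<forall>f :: int \<Rightarrow> 'a \<Rightarrow> 'a.
       (\<forall>n x y. norm (f n x - f n y) \<le> c * norm (x - y)) \<and>
       (\<forall>n. \<exists>g. homeomorphism UNIV UNIV (\<lambda>x. A n x + f n x) g) \<and>
       (SUP n. sup_norm (f n)) < \<infinity> \<longrightarrow>
       (\<exists>!H :: int \<Rightarrow> 'a \<Rightarrow> 'a.
          (\<forall>n. \<exists>g. homeomorphism UNIV UNIV (H n) g) \<and>
          (\<forall>n. H (n + 1) \<circ> A n = (\<lambda>x. A n x + f n x) \<circ> H n) \<and>
          (SUP n. sup_norm (\<lambda>x. H n x - x)) < \<infinity> \<and>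
          (\<forall>n x. H n x - x \<in> {s + u | s u. s \<in> S n \<and> u \<in> inv (A n) ` U (n + 1)})))"
proof -
  interpret generalized_dichotomy A S U D lam
    by unfold_locales (fact assms)+
  show ?thesis
  proof (intro exI[of _ "1 / (2 * green_const)"] conjI allI impI)
    show "0 < 1 / (2 * green_const)"
      using green_const_pos by simp
    fix c :: real and f :: "int \<Rightarrow> 'a \<Rightarrow> 'a"
    assume c: "0 < c \<and> c \<le> 1 / (2 * green_const)"
      and f: "(\<forall>n x y. norm (f n x - f n y) \<le> c * norm (x - y)) \<and>
        (\<forall>n. \<exists>g. homeomorphism UNIV UNIV (\<lambda>x. A n x + f n x) g) \<and>
        (SUP n. sup_norm (f n)) < \<infinity>"
    define G where "G n x = A n x + f n x" for n x
    have G: "small_perturbation G"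
      unfolding G_def using c f by (intro small_perturbation_add) auto
    obtain H where H: "conjugacy A G H" "\<And>n. \<exists>g. homeomorphism UNIV UNIV (H n) g"
      using conjugacy_homeomorphism[OF small_perturbation_self G] by blast
    have "\<exists>!H. (\<forall>n. \<exists>g. homeomorphism UNIV UNIV (H n) g) \<and> conjugacy A G H"
    proof (rule ex1I[of _ H])
      fix H'
      assume "(\<forall>n. \<exists>g. homeomorphism UNIV UNIV (H' n) g) \<and> conjugacy A G H'"
      then show "H' = H"
        using conjugacy_unique[OF bij_A G _ H(1)] by blast
    qed (use H in blast)
    then show "\<exists>!H. (\<forall>n. \<exists>g. homeomorphism UNIV UNIV (H n) g) \<and>
        (\<forall>n. H (n + 1) \<circ> A n = (\<lambda>x. A n x + f n x) \<circ> H n) \<and>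
        (SUP n. sup_norm (\<lambda>x. H n x - x)) < \<infinity> \<and>
        (\<forall>n x. H n x - x \<in> {s + u | s u. s \<in> S n \<and> u \<in> inv (A n) ` U (n + 1)})"
      unfolding conjugacy_iff G_def .
  qed
qed

end
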